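(* Let $\varphi$ be any Finsler norm in $\mathbb{R}^{d}$. Then there is a family of Finsler norms $(\varphi_{\zeta})_{\zeta>0}\subseteq C^{1,1}_{\mathrm{loc}}(\mathbb{R}^{d}\setminus\{0\})$ along with constants $\kappa(\varphi),\delta(\varphi)>0$ such that $\varphi_\zeta\to\varphi$ locally uniformly in $\mathbb{R}^d$ as $\zeta\to0^+$ and, for any $\zeta\in(0,1)$: (i) $\{\varphi_{\zeta}\le1\}$ satisfies a uniform interior ball condition with radius $\zeta$; (ii) for any $p\in\mathbb{R}^{d}\setminus\{0\}$, $\displaystyle \partial\varphi_{\zeta}^{*}(p)=\partial\varphi^{*}(p)+\frac{\zeta p}{\|p\|}$; (iii) $\varphi_{\zeta}\le\varphi$ pointwise in $\mathbb{R}^{d}$; (iv) $\varphi^{*}(D\varphi_{\zeta}(x))\ge\kappa(\varphi)$ for each $x\in\mathbb{R}^{d}\setminus\{0\}$; (v) $\overline{B}_{\delta(\varphi)}(0)\subseteq\{\varphi_{\zeta}\le1\}\subseteq\overline{B}_{\delta(\varphi)^{-1}}(0)$.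
   Context: A Finsler norm in $\mathbb{R}^d$ is a convex function $\varphi:\mathbb{R}^d\to[0,+\infty)$ with $\varphi(\lambda x)=\lambda\varphi(x)$ for all $\lambda>0$ and $\varphi(x)>0$ for $x\ne0$ (no symmetry is assumed). Its dual norm is $\varphi^{*}(p)=\max\{\langle p,q\rangle : \varphi(q)\le1\}$; $\varphi_\zeta^*$ is likewise the dual norm of $\varphi_\zeta$. $\partial$ denotes the subdifferential of a convex function, $\|\cdot\|$ the Euclidean norm, $\overline{B}_r(x)$ the closed Euclidean ball. A set $A\subseteq\mathbb{R}^d$ satisfies a uniform interior ball condition of radius $\zeta$ if for each $x\in\partial A$ there is a unit vector $e$ with $\overline{B}_\zeta(x-\zeta e)\subseteq\overline{A}$. *)

theory Defs
  imports "HOL-Analysis.Analysis"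
begin

definition finsler_norm :: "('a::euclidean_space \<Rightarrow> real) \<Rightarrow> bool" where
  "finsler_norm \<phi> \<longleftrightarrow>
     convex_on UNIV \<phi> \<and>
     (\<forall>x. 0 \<le> \<phi> x) \<and>
     (\<forall>c>0. \<forall>x. \<phi> (c *\<^sub>R x) = c * \<phi> x) \<and>
     (\<forall>x. x \<noteq> 0 \<longrightarrow> 0 < \<phi> x)"

text \<open>The supremum is a maximum whenever \<open>\<phi>\<close> is a Finsler norm; see
  \<open>dual_norm_is_max\<close> below.\<close>

definition dual_norm :: "('a::euclidean_space \<Rightarrow> real) \<Rightarrow> 'a \<Rightarrow> real" where
  "dual_norm \<phi> p = (SUP q\<in>{q. \<phi> q \<le> 1}. p \<bullet> q)"

definition subdifferential :: "('a::euclidean_space \<Rightarrow> real) \<Rightarrow> 'a \<Rightarrow> 'a set" where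
  "subdifferential f x = {v. \<forall>y. f x + v \<bullet> (y - x) \<le> f y}"

text \<open>Only meaningful at points of differentiability, where it is characterised by
  \<open>gradient_eqI\<close> below.\<close>

definition gradient :: "('a::euclidean_space \<Rightarrow> real) \<Rightarrow> 'a \<Rightarrow> 'a" where
  "gradient f x = (THE D. GDERIV f x :> D)"

definition C11_loc_on :: "'a::euclidean_space set \<Rightarrow> ('a \<Rightarrow> real) \<Rightarrow> bool" where
  "C11_loc_on U f \<longleftrightarrow>
     (\<forall>x\<in>U. f differentiable (at x)) \<and>
     (\<forall>K. compact K \<and> K \<subseteq> U \<longrightarrow> (\<exists>L. L-lipschitz_on K (gradient f)))"

definition uniform_interior_ball :: "real \<Rightarrow> 'a::euclidean_space set \<Rightarrow> bool" where
  "uniform_interior_ball r A \<longleftrightarrow>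
     (\<forall>x\<in>frontier A. \<exists>e. norm e = 1 \<and> cball (x - r *\<^sub>R e) r \<subseteq> closure A)"

lemma gradient_eqI:
  assumes "GDERIV f x :> D"
  shows "gradient f x = D"
  unfolding gradient_def
proof (rule the_equality[where P = "\<lambda>D. GDERIV f x :> D", OF assms])
  fix E assume "GDERIV f x :> E"
  with assms have "(\<lambda>h. h \<bullet> E) = (\<lambda>h. h \<bullet> D)"
    unfolding gderiv_def by (rule has_derivative_unique[rotated])
  then have "h \<bullet> E = h \<bullet> D" for h by metis
  then show "E = D" using vector_eq_ldot by blast
qed

lemma GDERIV_gradient:
  assumes "f differentiable (at x)"
  shows "GDERIV f x :> gradient f x"
proof -
  from assms obtain f' where f': "(f has_derivative f') (at x)"
    unfolding differentiable_def by blast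
  then interpret bounded_linear f' by (rule has_derivative_bounded_linear)
  have "f' h = h \<bullet> adjoint f' 1" for h
    using adjoint_works[OF linear_axioms, of h 1] by (simp add: inner_commute)
  then have "GDERIV f x :> adjoint f' 1"
    using f' unfolding gderiv_def by (metis (no_types, lifting) ext)
  then show ?thesis by (simp add: gradient_eqI)
qed

lemma finsler_norm_zero:
  assumes "finsler_norm \<phi>"
  shows "\<phi> 0 = 0"
proof -
  have "\<phi> (2 *\<^sub>R 0) = 2 * \<phi> 0"
    using assms unfolding finsler_norm_def by (metis zero_less_numeral)
  then show ?thesis by simp
qed

lemma finsler_norm_continuous:
  assumes "finsler_norm \<phi>"
  shows "continuous_on A \<phi>"
proof -
  have "continuous_on UNIV \<phi>"
    using assms unfolding finsler_norm_def by (intro convex_on_continuous) auto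
  then show ?thesis by (rule continuous_on_subset) simp
qed

lemma finsler_norm_compact_sublevel:
  fixes \<phi> :: "'a::euclidean_space \<Rightarrow> real"
  assumes "finsler_norm \<phi>"
  shows "compact {q. \<phi> q \<le> 1}"
proof -
  have "sphere (0::'a) 1 \<noteq> {}" by simp
  then obtain z where z: "z \<in> sphere 0 1" "\<And>y. y \<in> sphere 0 1 \<Longrightarrow> \<phi> z \<le> \<phi> y"
    using continuous_attains_inf[OF compact_sphere _ finsler_norm_continuous[OF assms]] by metis
  then have "z \<noteq> 0" by auto
  then have pos: "0 < \<phi> z" using assms unfolding finsler_norm_def by blast
  have "norm q \<le> 1 / \<phi> z" if q: "\<phi> q \<le> 1" for q
  proof (cases "q = 0")
    case False
    then have "\<phi> z \<le> \<phi> ((1 / norm q) *\<^sub>R q)" by (intro z) simp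
    also have "\<dots> = (1 / norm q) * \<phi> q"
      using False assms unfolding finsler_norm_def by simp
    also have "\<dots> \<le> 1 / norm q" using q False by (simp add: field_simps)
    finally show ?thesis using pos False by (simp add: field_simps)
  qed (use pos in simp)
  then have "bounded {q. \<phi> q \<le> 1}" unfolding bounded_iff by blast
  moreover have "closed {q. \<phi> q \<le> 1}"
    by (intro closed_Collect_le finsler_norm_continuous[OF assms] continuous_on_const)
  ultimately show ?thesis by (simp add: compact_eq_bounded_closed)
qed

lemma dual_norm_is_max:
  fixes \<phi> :: "'a::euclidean_space \<Rightarrow> real"
  assumes "finsler_norm \<phi>"
  shows "\<exists>q. \<phi> q \<le> 1 \<and> dual_norm \<phi> p = p \<bullet> q \<and> (\<forall>r. \<phi> r \<le> 1 \<longrightarrow> p \<bullet> r \<le> p \<bullet> q)"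
proof -
  have "0 \<in> {q. \<phi> q \<le> 1}" using finsler_norm_zero[OF assms] by simp
  then have "{q. \<phi> q \<le> 1} \<noteq> {}" by blast
  moreover have "continuous_on {q. \<phi> q \<le> 1} (\<lambda>q. p \<bullet> q)" by (intro continuous_intros)
  ultimately obtain q where q: "q \<in> {q. \<phi> q \<le> 1}" "\<And>r. r \<in> {q. \<phi> q \<le> 1} \<Longrightarrow> p \<bullet> r \<le> p \<bullet> q"
    using continuous_attains_sup[OF finsler_norm_compact_sublevel[OF assms]] by metis
  then have "dual_norm \<phi> p = p \<bullet> q"
    unfolding dual_norm_def by (intro cSup_eq_maximum) auto
  with q show ?thesis by auto
qed

end

theory Submission
  imports Defs
begin

text \<open>
  Let \<open>W = {\<phi> \<le> 1}\<close>. The approximation \<open>\<phi>\<^sub>\<zeta>\<close> is the norm whose unit ball is the Minkowski sum of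
  \<open>W\<close> with the closed Euclidean ball of radius \<open>\<zeta>\<close>: rolling a ball along \<open>W\<close> rounds its corners
  off. Support functions add under Minkowski sums, so \<open>\<phi>\<^sub>\<zeta>\<^sup>* = \<phi>\<^sup>* + \<zeta> \<parallel>\<cdot>\<parallel>\<close>, and the whole proof runs on
  the dual side: \<open>\<phi>\<^sub>\<zeta>\<close> is defined as the dual norm of \<open>\<phi>\<^sup>* + \<zeta> \<parallel>\<cdot>\<parallel>\<close>, and the biduality theorem
  \<open>dual_norm_dual_norm\<close> says that this sum is then its dual norm. The sum itself never has to be
  formed as a set.

  Most of the claims are read off from this formula. Duality reverses inequalities, which gives
  \<open>\<phi>\<^sub>\<zeta> \<le> \<phi>\<close>; if \<open>c \<parallel>\<cdot>\<parallel> \<le> \<phi>\<^sup>*\<close>, then \<open>\<phi>\<^sub>\<zeta>\<^sup>* \<le> (1 + \<zeta>/c) \<phi>\<^sup>*\<close> gives \<open>\<phi> \<le> (1 + \<zeta>/c) \<phi>\<^sub>\<zeta>\<close>, and hence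
  locally uniform convergence and bounds on the unit balls. Away from the origin the Euclidean norm
  is differentiable with gradient \<open>p/\<parallel>p\<parallel>\<close>, so the formula for the subdifferential is the sum rule
  for a convex and a differentiable convex function. That formula in turn gives the interior balls:
  a boundary point \<open>x\<close> with outer normal \<open>p\<close> lies in \<open>\<partial>\<phi>\<^sub>\<zeta>\<^sup>*(p)\<close>, so \<open>x - \<zeta> p/\<parallel>p\<parallel>\<close> lies in \<open>\<partial>\<phi>\<^sup>*(p)\<close>,
  hence in \<open>W\<close>, and the ball of radius \<open>\<zeta>\<close> around a point of \<open>W\<close> is in the unit ball of \<open>\<phi>\<^sub>\<zeta>\<close>.

  The heart of the matter is the regularity of \<open>\<phi>\<^sub>\<zeta>\<close>. For points \<open>u\<close>, \<open>v\<close> of the unit sphere of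
  \<open>\<phi>\<^sub>\<zeta>\<close>, let \<open>p\<close>, \<open>q\<close> be outer normals with \<open>\<phi>\<^sub>\<zeta>\<^sup>*(p) = \<phi>\<^sub>\<zeta>\<^sup>*(q) = 1\<close>. The points \<open>u - \<zeta> p/\<parallel>p\<parallel>\<close> and
  \<open>v - \<zeta> q/\<parallel>q\<parallel>\<close> are subgradients of \<open>\<phi>\<^sup>*\<close> at \<open>p\<close> and \<open>q\<close>, and monotonicity of the subdifferential
  becomes
  \<open>(u - v) \<bullet> (p - q) \<ge> \<zeta> (p/\<parallel>p\<parallel> - q/\<parallel>q\<parallel>) \<bullet> (p - q)\<close>.
  Since \<open>p\<close> and \<open>q\<close> are on the same dual sphere, the right-hand side is at least a constant times
  \<open>\<zeta> \<parallel>p - q\<parallel>\<^sup>2\<close>, and so \<open>\<parallel>p - q\<parallel>\<close> is at most a constant times \<open>\<parallel>u - v\<parallel> / \<zeta>\<close>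
  (\<open>outer_normal_lipschitz\<close>). A continuous selection of subgradients is a gradient
  (\<open>GDERIV_continuous_selection\<close>), so the normal is the gradient of \<open>\<phi>\<^sub>\<zeta>\<close>, and it is locally
  Lipschitz. Finally \<open>1 = \<phi>\<^sub>\<zeta>\<^sup>*(p) = \<phi>\<^sup>*(p) + \<zeta> \<parallel>p\<parallel> \<le> (1 + 1/c) \<phi>\<^sup>*(p)\<close> for \<open>\<zeta> < 1\<close> bounds the dual norm
  of the gradient from below.
\<close>

section \<open>Finsler norms as sublinear functions\<close>

lemma finsler_norm_nonneg: "finsler_norm f \<Longrightarrow> 0 \<le> f x"
  by (simp add: finsler_norm_def)

lemma finsler_norm_pos: "finsler_norm f \<Longrightarrow> x \<noteq> 0 \<Longrightarrow> 0 < f x"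
  by (simp add: finsler_norm_def)

lemma finsler_norm_scaleR:
  assumes "finsler_norm f" "0 \<le> c"
  shows "f (c *\<^sub>R x) = c * f x"
  using assms finsler_norm_zero[OF assms(1)]
  by (cases "c = 0") (auto simp: finsler_norm_def)

lemma finsler_norm_triangle:
  assumes "finsler_norm f"
  shows "f (x + y) \<le> f x + f y"
proof -
  have "convex_on UNIV f" using assms by (simp add: finsler_norm_def)
  then have "f ((1 - 1/2) *\<^sub>R (2 *\<^sub>R x) + (1/2) *\<^sub>R (2 *\<^sub>R y))
      \<le> (1 - 1/2) * f (2 *\<^sub>R x) + (1/2) * f (2 *\<^sub>R y)"
    by (intro convex_onD) auto
  then show ?thesis by (simp add: finsler_norm_scaleR[OF assms])
qed

lemma finsler_normI_sublinear:
  assumes zero: "f 0 = 0" and pos: "\<And>x. x \<noteq> 0 \<Longrightarrow> 0 < f x"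
    and scale: "\<And>c x. 0 < c \<Longrightarrow> f (c *\<^sub>R x) = c * f x"
    and add: "\<And>x y. f (x + y) \<le> f x + f y"
  shows "finsler_norm f"
proof -
  have scale0: "f (c *\<^sub>R x) = c * f x" if "0 \<le> c" for c x
    using that scale zero by (cases "c = 0") auto
  have "convex_on UNIV f"
    unfolding convex_on_def
    using add scale0 by (metis convex_UNIV)
  moreover have "0 \<le> f x" for x
    using pos[of x] zero by (cases "x = 0") auto
  ultimately show ?thesis
    using pos scale by (simp add: finsler_norm_def)
qed

lemma finsler_norm_equivalent_norm:
  fixes f :: "'a::euclidean_space \<Rightarrow> real"
  assumes "finsler_norm f"
  obtains m M where "0 < m" "0 < M" "\<And>x. m * norm x \<le> f x" "\<And>x. f x \<le> M * norm x"
proof -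
  have ne: "sphere (0::'a) 1 \<noteq> {}" by simp
  obtain z where z: "z \<in> sphere 0 1" "\<And>y. y \<in> sphere 0 1 \<Longrightarrow> f z \<le> f y"
    using continuous_attains_inf[OF compact_sphere ne finsler_norm_continuous[OF assms]] by metis
  obtain w where w: "w \<in> sphere 0 1" "\<And>y. y \<in> sphere 0 1 \<Longrightarrow> f y \<le> f w"
    using continuous_attains_sup[OF compact_sphere ne finsler_norm_continuous[OF assms]] by metis
  have eq: "f x = norm x * f (sgn x)" for x
    using finsler_norm_scaleR[OF assms, of "norm x" "sgn x"]
    by (cases "x = 0") (auto simp: sgn_div_norm finsler_norm_zero[OF assms])
  have "f z * norm x \<le> f x \<and> f x \<le> f w * norm x" for x
  proof (cases "x = 0")
    case False
    then have "sgn x \<in> sphere 0 1" by (simp add: norm_sgn)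
    then show ?thesis using z(2) w(2) eq[of x]
      by (metis mult.commute mult_left_mono norm_ge_zero)
  qed (simp add: finsler_norm_zero[OF assms])
  moreover have "0 < f z" "0 < f w"
    using z(1) w(1) by (auto intro!: finsler_norm_pos[OF assms])
  ultimately show thesis using that by blast
qed

lemma finsler_norm_lipschitz:
  assumes "finsler_norm f" and M: "\<And>x. f x \<le> M * norm x"
  shows "\<bar>f x - f y\<bar> \<le> M * norm (x - y)"
proof -
  have "f x \<le> f y + f (x - y)" "f y \<le> f x + f (y - x)"
    using finsler_norm_triangle[OF assms(1), of y "x - y"]
      finsler_norm_triangle[OF assms(1), of x "y - x"] by simp_all
  then show ?thesis
    using M[of "x - y"] M[of "y - x"] by (simp add: norm_minus_commute)
qed

text \<open>
  The radial projection onto the unit sphere of a Finsler norm. It serves on both sides of the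
  duality: for \<open>\<phi>\<^sub>\<zeta>\<close> it reduces a Lipschitz estimate for a 0-homogeneous map to the unit sphere, and
  for \<open>\<phi>\<^sub>\<zeta>\<^sup>*\<close> it bounds the distance of two points of the dual sphere by that of their directions.
\<close>

lemma finsler_radial_projection_lipschitz:
  fixes f :: "'a::euclidean_space \<Rightarrow> real"
  assumes f: "finsler_norm f"
  obtains C where "0 < C"
    "\<And>x y. x \<noteq> 0 \<Longrightarrow> y \<noteq> 0 \<Longrightarrow>
       norm ((1 / f x) *\<^sub>R x - (1 / f y) *\<^sub>R y) \<le> C / norm x * norm (x - y)"
proof -
  obtain m M where mM: "0 < m" "0 < M" "\<And>x. m * norm x \<le> f x" "\<And>x. f x \<le> M * norm x"
    using finsler_norm_equivalent_norm[OF f] by blast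
  have "norm ((1 / f x) *\<^sub>R x - (1 / f y) *\<^sub>R y) \<le> ((1 + M / m) / m) / norm x * norm (x - y)"
    if "x \<noteq> 0" "y \<noteq> 0" for x y
  proof -
    have fx: "0 < f x" and fy: "0 < f y" using that finsler_norm_pos[OF f] by auto
    have "(1 / f x) * ((f y - f x) / f y) = 1 / f x - 1 / f y"
      using fx fy by (simp add: field_simps)
    then have "(1 / f x) *\<^sub>R (((f y - f x) / f y) *\<^sub>R y) = (1 / f x) *\<^sub>R y - (1 / f y) *\<^sub>R y"
      by (simp only: scaleR_scaleR scaleR_left_diff_distrib)
    then have "(1 / f x) *\<^sub>R x - (1 / f y) *\<^sub>R y
        = (1 / f x) *\<^sub>R ((x - y) + ((f y - f x) / f y) *\<^sub>R y)"
      by (simp only: scaleR_right_distrib scaleR_right_diff_distrib) simp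
    then have "norm ((1 / f x) *\<^sub>R x - (1 / f y) *\<^sub>R y)
        = (1 / f x) * norm ((x - y) + ((f y - f x) / f y) *\<^sub>R y)"
      using fx by simp
    also have "\<dots> \<le> (1 / f x) * (norm (x - y) + \<bar>f y - f x\<bar> * (norm y / f y))"
      using fx fy norm_triangle_ineq[of "x - y" "((f y - f x) / f y) *\<^sub>R y"]
      by (intro mult_left_mono) auto
    also have "\<dots> \<le> (1 / f x) * (norm (x - y) + (M * norm (x - y)) * (1 / m))"
    proof (intro mult_left_mono add_left_mono mult_mono)
      show "\<bar>f y - f x\<bar> \<le> M * norm (x - y)"
        using finsler_norm_lipschitz[OF f mM(4), of y x] by (simp add: norm_minus_commute)
      show "norm y / f y \<le> 1 / m"
        using mM(3)[of y] mM(1) fy by (simp add: field_simps)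
    qed (use fx fy mM in auto)
    also have "\<dots> = (1 / f x) * ((1 + M / m) * norm (x - y))"
      by (simp add: algebra_simps)
    also have "\<dots> \<le> (1 / (m * norm x)) * ((1 + M / m) * norm (x - y))"
      using fx mM that by (intro mult_right_mono divide_left_mono) auto
    finally show ?thesis by simp
  qed
  moreover have "0 < (1 + M / m) / m" using mM by (simp add: add_pos_pos)
  ultimately show thesis using that by blast
qed

section \<open>The dual norm and biduality\<close>

lemma inner_le_dual_norm:
  assumes "finsler_norm f" "f q \<le> 1"
  shows "p \<bullet> q \<le> dual_norm f p"
  using dual_norm_is_max[OF assms(1), of p] assms(2) by auto

lemma dual_norm_leI:
  assumes "finsler_norm f" "\<And>q. f q \<le> 1 \<Longrightarrow> p \<bullet> q \<le> b"
  shows "dual_norm f p \<le> b"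
  using dual_norm_is_max[OF assms(1), of p] assms(2) by auto

lemma finsler_norm_dual_norm:
  assumes f: "finsler_norm f"
  shows "finsler_norm (dual_norm f)"
proof (rule finsler_normI_sublinear)
  have "f 0 \<le> 1" by (simp add: finsler_norm_zero[OF f])
  then have "0 \<le> dual_norm f 0" using inner_le_dual_norm[OF f, of 0 0] by simp
  moreover have "dual_norm f 0 \<le> 0" by (rule dual_norm_leI[OF f]) simp
  ultimately show "dual_norm f 0 = 0" by simp
next
  fix x :: 'a assume x: "x \<noteq> 0"
  have fx: "0 < f x" using finsler_norm_pos[OF f x] .
  have "f ((1 / f x) *\<^sub>R x) \<le> 1"
    using fx by (simp add: finsler_norm_scaleR[OF f])
  from inner_le_dual_norm[OF f this, of x] have "(x \<bullet> x) / f x \<le> dual_norm f x" by simp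
  moreover have "0 < (x \<bullet> x) / f x" using x fx by simp
  ultimately show "0 < dual_norm f x" by linarith
next
  fix c :: real and x :: 'a assume c: "0 < c"
  have le: "dual_norm f (c *\<^sub>R x) \<le> c * dual_norm f x" if "0 < c" for c x
    by (rule dual_norm_leI[OF f]) (use that inner_le_dual_norm[OF f] in simp)
  from le[of "1 / c" "c *\<^sub>R x"] c have "c * dual_norm f x \<le> dual_norm f (c *\<^sub>R x)"
    by (simp add: field_simps)
  with le[OF c, of x] show "dual_norm f (c *\<^sub>R x) = c * dual_norm f x" by simp
next
  fix x y :: 'a
  show "dual_norm f (x + y) \<le> dual_norm f x + dual_norm f y"
    by (rule dual_norm_leI[OF f])
      (use inner_le_dual_norm[OF f] in \<open>simp add: inner_add_left add_mono\<close>)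
qed

lemma inner_le_dual_norm_mult:
  assumes f: "finsler_norm f"
  shows "p \<bullet> x \<le> dual_norm f p * f x"
proof (cases "x = 0")
  case False
  then have fx: "0 < f x" by (rule finsler_norm_pos[OF f])
  then have "f ((1 / f x) *\<^sub>R x) \<le> 1"
    by (simp add: finsler_norm_scaleR[OF f])
  from inner_le_dual_norm[OF f this, of p] fx show ?thesis by (simp add: field_simps)
qed (simp add: finsler_norm_zero[OF f])

lemma dual_norm_antimono:
  assumes f: "finsler_norm f" and g: "finsler_norm g" and le: "\<And>x. f x \<le> g x"
  shows "dual_norm g p \<le> dual_norm f p"
  by (rule dual_norm_leI[OF g]) (use le order_trans in \<open>blast intro: inner_le_dual_norm[OF f]\<close>)

lemma dual_norm_le_1_iff:
  assumes f: "finsler_norm f"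
  shows "dual_norm f v \<le> 1 \<longleftrightarrow> (\<forall>q. v \<bullet> q \<le> f q)"
proof
  assume "dual_norm f v \<le> 1"
  then have "dual_norm f v * f q \<le> 1 * f q" for q
    by (intro mult_right_mono finsler_norm_nonneg[OF f])
  then show "\<forall>q. v \<bullet> q \<le> f q"
    using inner_le_dual_norm_mult[OF f, of v] by (metis mult_1 order_trans)
next
  assume "\<forall>q. v \<bullet> q \<le> f q"
  then show "dual_norm f v \<le> 1"
    by (intro dual_norm_leI[OF f]) (blast intro: order_trans)
qed

text \<open>
  The separating hyperplane theorem: a point outside the unit ball is cut off by some linear
  functional, which then exceeds the support function of the ball there.
\<close>

lemma finsler_norm_le_1_if_dual:
  fixes f :: "'a::euclidean_space \<Rightarrow> real"
  assumes f: "finsler_norm f" and x: "\<And>p. p \<bullet> x \<le> dual_norm f p"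
  shows "f x \<le> 1"
proof (rule ccontr)
  assume "\<not> f x \<le> 1"
  then have "x \<notin> {q. f q \<le> 1}" by simp
  moreover have "convex {q. f q \<le> 1}"
  proof (rule convexI)
    fix y z u v
    assume yz: "y \<in> {q. f q \<le> 1}" "z \<in> {q. f q \<le> 1}"
      and uv: "0 \<le> u" "0 \<le> v" "u + v = (1::real)"
    have "f (u *\<^sub>R y + v *\<^sub>R z) \<le> u * f y + v * f z"
      using finsler_norm_triangle[OF f, of "u *\<^sub>R y" "v *\<^sub>R z"] uv
      by (simp add: finsler_norm_scaleR[OF f])
    also have "\<dots> \<le> 1" using convex_bound_le[of "f y" 1 "f z" u v] yz uv by simp
    finally show "u *\<^sub>R y + v *\<^sub>R z \<in> {q. f q \<le> 1}" by simp
  qed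
  moreover have "closed {q. f q \<le> 1}"
    using finsler_norm_compact_sublevel[OF f] by (rule compact_imp_closed)
  ultimately obtain a b where ab: "a \<bullet> x < b" "\<And>q. f q \<le> 1 \<Longrightarrow> b < a \<bullet> q"
    using separating_hyperplane_closed_point by (metis mem_Collect_eq)
  have "dual_norm f (- a) \<le> - b"
    by (rule dual_norm_leI[OF f]) (use ab(2) less_imp_le in force)
  with x[of "- a"] ab(1) show False by simp
qed

theorem dual_norm_dual_norm:
  assumes f: "finsler_norm f"
  shows "dual_norm (dual_norm f) = f"
proof
  fix x
  have f': "finsler_norm (dual_norm f)" and f'': "finsler_norm (dual_norm (dual_norm f))"
    using f by (simp_all add: finsler_norm_dual_norm)
  show "dual_norm (dual_norm f) x = f x"
  proof (rule antisym)
    show "dual_norm (dual_norm f) x \<le> f x"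
    proof (rule dual_norm_leI[OF f'])
      fix p assume "dual_norm f p \<le> 1"
      then have "p \<bullet> x \<le> f x" by (simp add: dual_norm_le_1_iff[OF f])
      then show "x \<bullet> p \<le> f x" by (simp add: inner_commute)
    qed
    show "f x \<le> dual_norm (dual_norm f) x"
    proof (cases "x = 0")
      case False
      define t where "t = dual_norm (dual_norm f) x"
      have t: "0 < t" unfolding t_def using finsler_norm_pos[OF f'' False] .
      have "dual_norm (dual_norm f) ((1 / t) *\<^sub>R x) \<le> 1"
        using t by (simp add: finsler_norm_scaleR[OF f''] flip: t_def)
      then have "f ((1 / t) *\<^sub>R x) \<le> 1"
        by (intro finsler_norm_le_1_if_dual[OF f])
          (simp add: dual_norm_le_1_iff[OF f'] inner_commute)
      with t have "f x \<le> t" by (simp add: finsler_norm_scaleR[OF f])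
      then show ?thesis by (simp add: t_def)
    qed (simp add: finsler_norm_zero[OF f] finsler_norm_zero[OF f''])
  qed
qed

section \<open>Subdifferentials\<close>

text \<open>
  By positive homogeneity, testing the subgradient inequality at \<open>0\<close> and \<open>2p\<close> pins down
  \<open>v \<bullet> p\<close>. Thus \<open>v\<close> is a subgradient of a dual norm at \<open>p\<close> exactly if it is a point of the
  unit ball at which \<open>p\<close> attains its maximum.
\<close>

lemma subdifferential_finsler_norm:
  assumes f: "finsler_norm f"
  shows "subdifferential f p = {v. v \<bullet> p = f p \<and> dual_norm f v \<le> 1}"
proof (intro set_eqI iffI)
  fix v assume "v \<in> subdifferential f p"
  then have v: "f p + v \<bullet> (y - p) \<le> f y" for y by (simp add: subdifferential_def)
  have "v \<bullet> p = f p"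
    using v[of "2 *\<^sub>R p"] v[of 0]
    by (simp add: finsler_norm_scaleR[OF f] finsler_norm_zero[OF f] inner_diff_right)
  with v show "v \<in> {v. v \<bullet> p = f p \<and> dual_norm f v \<le> 1}"
    by (simp add: dual_norm_le_1_iff[OF f] inner_diff_right)
next
  fix v assume "v \<in> {v. v \<bullet> p = f p \<and> dual_norm f v \<le> 1}"
  then show "v \<in> subdifferential f p"
    by (simp add: subdifferential_def dual_norm_le_1_iff[OF f] inner_diff_right)
qed

lemma subdifferential_monotone:
  assumes "v \<in> subdifferential f p" "w \<in> subdifferential f q"
  shows "0 \<le> (v - w) \<bullet> (p - q)"
proof -
  have "f p + v \<bullet> (q - p) \<le> f q" "f q + w \<bullet> (p - q) \<le> f p"
    using assms by (simp_all add: subdifferential_def)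
  then show ?thesis by (simp add: inner_diff_left inner_diff_right)
qed

text \<open>
  The nontrivial inclusion compares \<open>f + g\<close> at \<open>x\<close> and at \<open>x + t (y - x)\<close>: convexity bounds the
  increment of \<open>f\<close> by \<open>t (f y - f x)\<close>, and as \<open>t\<close> tends to \<open>0\<close> the difference quotient of \<open>g\<close>
  becomes \<open>v \<bullet> (y - x)\<close>.
\<close>

lemma subdifferential_add_differentiable:
  assumes f: "convex_on UNIV f" and g: "GDERIV g x :> v" and v: "v \<in> subdifferential g x"
  shows "subdifferential (\<lambda>y. f y + g y) x = (\<lambda>w. w + v) ` subdifferential f x"
proof (intro set_eqI iffI)
  fix u assume "u \<in> (\<lambda>w. w + v) ` subdifferential f x"
  then obtain w where u: "u = w + v" and w: "\<And>y. f x + w \<bullet> (y - x) \<le> f y"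
    by (auto simp: subdifferential_def)
  have "f x + g x + u \<bullet> (y - x) \<le> f y + g y" for y
  proof -
    have "g x + v \<bullet> (y - x) \<le> g y" using v by (simp add: subdifferential_def)
    with w[of y] show ?thesis unfolding u inner_add_left by linarith
  qed
  then show "u \<in> subdifferential (\<lambda>y. f y + g y) x" by (simp add: subdifferential_def)
next
  fix u assume "u \<in> subdifferential (\<lambda>y. f y + g y) x"
  then have u: "f x + g x + u \<bullet> (y - x) \<le> f y + g y" for y by (simp add: subdifferential_def)
  have "f x + (u - v) \<bullet> (y - x) \<le> f y" for y
  proof -
    define d where "d = y - x"
    have "((\<lambda>t. g (x + t *\<^sub>R d)) has_derivative (\<lambda>t. (t *\<^sub>R d) \<bullet> v)) (at 0)"
    proof -
      have "((\<lambda>t::real. x + t *\<^sub>R d) has_derivative (\<lambda>t. t *\<^sub>R d)) (at 0)"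
        by (auto intro!: derivative_eq_intros)
      moreover have "(g has_derivative (\<lambda>h. h \<bullet> v)) (at (x + 0 *\<^sub>R d))"
        using g by (simp add: gderiv_def)
      ultimately show ?thesis by (rule has_derivative_compose)
    qed
    then have "((\<lambda>t. g (x + t *\<^sub>R d)) has_field_derivative (d \<bullet> v)) (at 0)"
      by (rule has_derivative_imp_has_field_derivative) simp
    then have "((\<lambda>t. (g (x + t *\<^sub>R d) - g x) / t) \<longlongrightarrow> d \<bullet> v) (at 0)"
      by (simp add: has_field_derivative_iff)
    then have lim: "((\<lambda>t. (g (x + t *\<^sub>R d) - g x) / t) \<longlongrightarrow> d \<bullet> v) (at_right 0)"
      by (rule filterlim_mono) (simp_all add: at_le)
    have "\<forall>\<^sub>F t in at_right 0. f x - f y + u \<bullet> d \<le> (g (x + t *\<^sub>R d) - g x) / t"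
      unfolding eventually_at_right_field
    proof (intro exI[of _ 1] conjI allI impI)
      fix t :: real assume t: "0 < t" "t < 1"
      have "f ((1 - t) *\<^sub>R x + t *\<^sub>R y) \<le> (1 - t) * f x + t * f y"
        using f t by (intro convex_onD) auto
      moreover have "(1 - t) *\<^sub>R x + t *\<^sub>R y = x + t *\<^sub>R d"
        by (simp add: d_def algebra_simps)
      moreover have "f x + g x + t * (u \<bullet> d) \<le> f (x + t *\<^sub>R d) + g (x + t *\<^sub>R d)"
        using u[of "x + t *\<^sub>R d"] by simp
      ultimately have "t * (f x - f y + u \<bullet> d) \<le> g (x + t *\<^sub>R d) - g x"
        by (simp add: algebra_simps)
      with t show "f x - f y + u \<bullet> d \<le> (g (x + t *\<^sub>R d) - g x) / t"
        by (simp add: pos_le_divide_eq mult.commute)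
    qed simp
    from tendsto_lowerbound[OF lim this] have "f x - f y + u \<bullet> d \<le> d \<bullet> v" by simp
    then show ?thesis by (simp add: d_def inner_diff_left inner_commute[of v])
  qed
  then have "u - v \<in> subdifferential f x" by (simp add: subdifferential_def)
  then show "u \<in> (\<lambda>w. w + v) ` subdifferential f x" by (force simp: image_iff)
qed

text \<open>
  The subgradient inequalities at \<open>x\<close> and at \<open>y\<close> enclose the remainder
  \<open>f y - f x - P x \<bullet> (y - x)\<close> between \<open>0\<close> and \<open>(P y - P x) \<bullet> (y - x)\<close>.
\<close>

lemma GDERIV_continuous_selection:
  assumes sub: "\<And>y. P y \<in> subdifferential f y" and cont: "isCont P x"
  shows "GDERIV f x :> P x"
  unfolding gderiv_def has_derivative_at_within
proof (intro conjI)
  show "bounded_linear (\<lambda>h. h \<bullet> P x)" by (rule bounded_linear_inner_left)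
  have lim: "((\<lambda>y. norm (P y - P x)) \<longlongrightarrow> 0) (at x)"
    using cont by (simp add: isCont_def LIM_zero tendsto_norm_zero)
  show "((\<lambda>y. (f y - f x - (y - x) \<bullet> P x) /\<^sub>R norm (y - x)) \<longlongrightarrow> 0) (at x)"
  proof (rule tendsto_0_le[OF lim, where K = 1], intro always_eventually allI)
    fix y
    have "f x + P x \<bullet> (y - x) \<le> f y" "f y + P y \<bullet> (x - y) \<le> f x"
      using sub by (simp_all add: subdifferential_def)
    moreover have "(P y - P x) \<bullet> (y - x) \<le> norm (P y - P x) * norm (y - x)"
      by (rule norm_cauchy_schwarz)
    ultimately have "\<bar>f y - f x - (y - x) \<bullet> P x\<bar> \<le> norm (P y - P x) * norm (y - x)"
      by (simp add: inner_diff_left inner_diff_right inner_commute)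
    then show "norm ((f y - f x - (y - x) \<bullet> P x) /\<^sub>R norm (y - x)) \<le> norm (norm (P y - P x)) * 1"
      by (cases "y = x") (simp_all add: field_simps)
  qed
qed

section \<open>Adding a multiple of the Euclidean norm to the dual norm\<close>

text \<open>
  The support function of the Minkowski sum of \<open>{\<phi> \<le> 1}\<close> and the ball of radius \<open>\<zeta>\<close>.
\<close>

definition thickened_dual :: "('a::euclidean_space \<Rightarrow> real) \<Rightarrow> real \<Rightarrow> 'a \<Rightarrow> real" where
  "thickened_dual \<phi> \<zeta> p = dual_norm \<phi> p + \<zeta> * norm p"

text \<open>
  The norm \<open>\<phi>\<^sub>\<zeta>\<close> of the theorem, that is, the gauge of that Minkowski sum.
\<close>

definition rounded :: "('a::euclidean_space \<Rightarrow> real) \<Rightarrow> real \<Rightarrow> 'a \<Rightarrow> real" where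
  "rounded \<phi> \<zeta> = dual_norm (thickened_dual \<phi> \<zeta>)"

text \<open>
  A point of the dual unit ball at which \<open>x\<close> attains its maximum. For \<open>x \<noteq> 0\<close> it is an outer normal
  of the level set of \<open>\<phi>\<^sub>\<zeta>\<close> through \<open>x\<close>, and it turns out to be the gradient of \<open>\<phi>\<^sub>\<zeta>\<close> there;
  before this is known, it is merely some choice of subgradient.
\<close>

definition outer_normal :: "('a::euclidean_space \<Rightarrow> real) \<Rightarrow> real \<Rightarrow> 'a \<Rightarrow> 'a" where
  "outer_normal \<phi> \<zeta> x =
     (SOME p. thickened_dual \<phi> \<zeta> p \<le> 1 \<and> rounded \<phi> \<zeta> x = x \<bullet> p)"

context
  fixes \<phi> :: "'a::euclidean_space \<Rightarrow> real" and \<zeta> :: real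
  assumes \<phi>: "finsler_norm \<phi>" and \<zeta>: "0 < \<zeta>"
begin

lemma finsler_norm_thickened_dual: "finsler_norm (thickened_dual \<phi> \<zeta>)"
proof (rule finsler_normI_sublinear)
  note \<phi>' = finsler_norm_dual_norm[OF \<phi>]
  show "thickened_dual \<phi> \<zeta> 0 = 0"
    by (simp add: thickened_dual_def finsler_norm_zero[OF \<phi>'])
  show "0 < thickened_dual \<phi> \<zeta> x" if "x \<noteq> 0" for x
    using finsler_norm_pos[OF \<phi>' that] that \<zeta> by (simp add: thickened_dual_def add_pos_pos)
  show "thickened_dual \<phi> \<zeta> (c *\<^sub>R x) = c * thickened_dual \<phi> \<zeta> x" if "0 < c" for c x
    using that by (simp add: thickened_dual_def finsler_norm_scaleR[OF \<phi>'] algebra_simps)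
  show "thickened_dual \<phi> \<zeta> (x + y) \<le> thickened_dual \<phi> \<zeta> x + thickened_dual \<phi> \<zeta> y" for x y
  proof -
    have "\<zeta> * norm (x + y) \<le> \<zeta> * (norm x + norm y)"
      using \<zeta> norm_triangle_ineq by (intro mult_left_mono) auto
    then show ?thesis
      using finsler_norm_triangle[OF \<phi>', of x y] by (simp add: thickened_dual_def algebra_simps)
  qed
qed

lemma finsler_norm_rounded: "finsler_norm (rounded \<phi> \<zeta>)"
  unfolding rounded_def by (rule finsler_norm_dual_norm[OF finsler_norm_thickened_dual])

lemma dual_norm_rounded: "dual_norm (rounded \<phi> \<zeta>) = thickened_dual \<phi> \<zeta>"
  unfolding rounded_def by (rule dual_norm_dual_norm[OF finsler_norm_thickened_dual])

lemma rounded_le: "rounded \<phi> \<zeta> x \<le> \<phi> x"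
proof -
  have "dual_norm (thickened_dual \<phi> \<zeta>) x \<le> dual_norm (dual_norm \<phi>) x"
    by (intro dual_norm_antimono finsler_norm_thickened_dual finsler_norm_dual_norm[OF \<phi>])
      (use \<zeta> in \<open>simp add: thickened_dual_def\<close>)
  then show ?thesis by (simp add: rounded_def dual_norm_dual_norm[OF \<phi>])
qed

text \<open>
  On the dual side \<open>\<phi>\<^sub>\<zeta>\<^sup>* \<le> (1 + \<zeta>/c) \<phi>\<^sup>*\<close>, and passing to dual norms reverses the inequality.
\<close>

lemma le_rounded:
  assumes c: "0 < c" "\<And>p. c * norm p \<le> dual_norm \<phi> p"
  shows "\<phi> x \<le> (1 + \<zeta> / c) * rounded \<phi> \<zeta> x"
proof -
  note \<phi>' = finsler_norm_dual_norm[OF \<phi>]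
  let ?r = "1 + \<zeta> / c"
  have r: "0 < ?r" using \<zeta> c by (simp add: add_pos_pos)
  have "dual_norm (dual_norm \<phi>) x \<le> ?r * rounded \<phi> \<zeta> x"
  proof (rule dual_norm_leI[OF \<phi>'])
    fix p assume p: "dual_norm \<phi> p \<le> 1"
    have "\<zeta> * norm p \<le> \<zeta> / c"
      using c(2)[of p] p c(1) \<zeta> by (simp add: field_simps)
    with p have "thickened_dual \<phi> \<zeta> p \<le> ?r" by (simp add: thickened_dual_def)
    then have "rounded \<phi> \<zeta> x * thickened_dual \<phi> \<zeta> p \<le> rounded \<phi> \<zeta> x * ?r"
      by (intro mult_left_mono finsler_norm_nonneg[OF finsler_norm_rounded])
    moreover have "x \<bullet> p \<le> rounded \<phi> \<zeta> x * thickened_dual \<phi> \<zeta> p"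
      unfolding rounded_def by (rule inner_le_dual_norm_mult[OF finsler_norm_thickened_dual])
    ultimately show "x \<bullet> p \<le> ?r * rounded \<phi> \<zeta> x" by (simp add: mult.commute)
  qed
  then show ?thesis by (simp add: dual_norm_dual_norm[OF \<phi>])
qed

lemma subdifferential_thickened_dual:
  assumes p: "p \<noteq> 0"
  shows "subdifferential (thickened_dual \<phi> \<zeta>) p =
    (\<lambda>v. v + (\<zeta> / norm p) *\<^sub>R p) ` subdifferential (dual_norm \<phi>) p"
  unfolding thickened_dual_def
proof (rule subdifferential_add_differentiable)
  show "convex_on UNIV (dual_norm \<phi>)"
    using finsler_norm_dual_norm[OF \<phi>] by (simp add: finsler_norm_def)
  have "((\<lambda>p. \<zeta> * norm p) has_derivative (\<lambda>h. \<zeta> * (h \<bullet> sgn p))) (at p)"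
    using GDERIV_norm[OF p] by (intro has_derivative_mult_right) (simp add: gderiv_def)
  then show "GDERIV (\<lambda>p. \<zeta> * norm p) p :> (\<zeta> / norm p) *\<^sub>R p"
    by (simp add: gderiv_def sgn_div_norm divide_inverse mult_ac)
  show "(\<zeta> / norm p) *\<^sub>R p \<in> subdifferential (\<lambda>p. \<zeta> * norm p) p"
    unfolding subdifferential_def mem_Collect_eq
  proof
    fix y
    have "\<zeta> / norm p * (p \<bullet> y) \<le> \<zeta> / norm p * (norm p * norm y)"
      using \<zeta> by (intro mult_left_mono norm_cauchy_schwarz) auto
    with p show "\<zeta> * norm p + ((\<zeta> / norm p) *\<^sub>R p) \<bullet> (y - p) \<le> \<zeta> * norm y"
      by (simp add: inner_diff_right dot_square_norm power2_eq_square algebra_simps)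
  qed
qed

text \<open>
  The ball touching the boundary at \<open>x\<close> is centred at the point \<open>w\<close> of \<open>{\<phi> \<le> 1}\<close> with the same
  outer normal, which the subdifferential formula supplies.
\<close>

lemma uniform_interior_ball_rounded: "uniform_interior_ball \<zeta> {x. rounded \<phi> \<zeta> x \<le> 1}"
  unfolding uniform_interior_ball_def
proof
  note T = finsler_norm_thickened_dual and R = finsler_norm_rounded
    and \<phi>' = finsler_norm_dual_norm[OF \<phi>]
  fix x assume x: "x \<in> frontier {x. rounded \<phi> \<zeta> x \<le> 1}"
  have cl: "closed {x. rounded \<phi> \<zeta> x \<le> 1}"
    using finsler_norm_compact_sublevel[OF R] by (rule compact_imp_closed)
  have op: "open {x. rounded \<phi> \<zeta> x < 1}"
    by (intro open_Collect_less finsler_norm_continuous[OF R] continuous_on_const)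
  have "rounded \<phi> \<zeta> x \<le> 1" using x cl frontier_subset_closed by blast
  moreover have "\<not> rounded \<phi> \<zeta> x < 1"
  proof
    assume "rounded \<phi> \<zeta> x < 1"
    then have "x \<in> interior {x. rounded \<phi> \<zeta> x \<le> 1}"
      using op by (intro interiorI[of "{x. rounded \<phi> \<zeta> x < 1}"]) auto
    with x show False by (simp add: frontier_def)
  qed
  ultimately have x1: "rounded \<phi> \<zeta> x = 1" by simp
  obtain p where p: "thickened_dual \<phi> \<zeta> p \<le> 1" "rounded \<phi> \<zeta> x = x \<bullet> p"
    using dual_norm_is_max[OF T, of x] by (auto simp: rounded_def)
  have p0: "p \<noteq> 0" using p x1 by auto
  have "x \<bullet> p \<le> thickened_dual \<phi> \<zeta> p"
    using x1 dual_norm_le_1_iff[OF T, of x] by (simp add: rounded_def)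
  with p x1 have "x \<in> subdifferential (thickened_dual \<phi> \<zeta>) p"
    by (simp add: subdifferential_finsler_norm[OF T] rounded_def)
  then obtain w where w: "w \<in> subdifferential (dual_norm \<phi>) p" and xw: "x = w + \<zeta> *\<^sub>R sgn p"
    by (auto simp: subdifferential_thickened_dual[OF p0] sgn_div_norm divide_inverse)
  have wq: "w \<bullet> q \<le> dual_norm \<phi> q" for q
    using w by (simp add: subdifferential_finsler_norm[OF \<phi>'] dual_norm_le_1_iff[OF \<phi>'])
  show "\<exists>e. norm e = 1 \<and> cball (x - \<zeta> *\<^sub>R e) \<zeta> \<subseteq> closure {x. rounded \<phi> \<zeta> x \<le> 1}"
  proof (intro exI[of _ "sgn p"] conjI subsetI)
    show "norm (sgn p) = 1" using p0 by (simp add: norm_sgn)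
    fix y assume "y \<in> cball (x - \<zeta> *\<^sub>R sgn p) \<zeta>"
    then have y: "norm (y - w) \<le> \<zeta>" by (simp add: xw dist_norm norm_minus_commute)
    have "y \<bullet> q \<le> thickened_dual \<phi> \<zeta> q" for q
    proof -
      have "(y - w) \<bullet> q \<le> \<zeta> * norm q"
        using y norm_cauchy_schwarz[of "y - w" q] by (meson mult_right_mono norm_ge_zero order_trans)
      with wq[of q] show ?thesis by (simp add: thickened_dual_def inner_diff_left)
    qed
    then have "rounded \<phi> \<zeta> y \<le> 1" by (simp add: rounded_def dual_norm_le_1_iff[OF T])
    then show "y \<in> closure {x. rounded \<phi> \<zeta> x \<le> 1}"
      by (intro subsetD[OF closure_subset]) simp
  qed
qed

lemma outer_normal:
  shows outer_normal_inner: "x \<bullet> outer_normal \<phi> \<zeta> x = rounded \<phi> \<zeta> x"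
    and outer_normal_le: "thickened_dual \<phi> \<zeta> (outer_normal \<phi> \<zeta> x) \<le> 1"
proof -
  have "\<exists>p. thickened_dual \<phi> \<zeta> p \<le> 1 \<and> rounded \<phi> \<zeta> x = x \<bullet> p"
    using dual_norm_is_max[OF finsler_norm_thickened_dual, of x] by (auto simp: rounded_def)
  from someI_ex[OF this] show "x \<bullet> outer_normal \<phi> \<zeta> x = rounded \<phi> \<zeta> x"
    "thickened_dual \<phi> \<zeta> (outer_normal \<phi> \<zeta> x) \<le> 1"
    by (simp_all add: outer_normal_def)
qed

lemma thickened_dual_outer_normal:
  assumes x: "x \<noteq> 0"
  shows "thickened_dual \<phi> \<zeta> (outer_normal \<phi> \<zeta> x) = 1"
proof -
  let ?p = "outer_normal \<phi> \<zeta> x"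
  have "rounded \<phi> \<zeta> x \<le> rounded \<phi> \<zeta> x * thickened_dual \<phi> \<zeta> ?p"
    using inner_le_dual_norm_mult[OF finsler_norm_thickened_dual, of x ?p]
    by (simp add: outer_normal_inner rounded_def)
  moreover have "0 < rounded \<phi> \<zeta> x" by (rule finsler_norm_pos[OF finsler_norm_rounded x])
  ultimately have "1 \<le> thickened_dual \<phi> \<zeta> ?p" by simp
  with outer_normal_le[of x] show ?thesis by simp
qed

lemma outer_normal_subdifferential_rounded:
  "outer_normal \<phi> \<zeta> x \<in> subdifferential (rounded \<phi> \<zeta>) x"
  using outer_normal_inner[of x] outer_normal_le[of x]
  by (simp add: subdifferential_finsler_norm[OF finsler_norm_rounded] dual_norm_rounded
      inner_commute)

text \<open>
  The duality of normals and points: the outer normal at \<open>x\<close> attains its maximum over the unit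
  ball of \<open>\<phi>\<^sub>\<zeta>\<close> at the multiple of \<open>x\<close> on the unit sphere. Moving this point inwards by \<open>\<zeta>\<close> gives a
  subgradient of the original dual norm.
\<close>

lemma subdifferential_dual_norm_outer_normal:
  assumes x: "x \<noteq> 0"
  shows "(1 / rounded \<phi> \<zeta> x) *\<^sub>R x - \<zeta> *\<^sub>R sgn (outer_normal \<phi> \<zeta> x)
    \<in> subdifferential (dual_norm \<phi>) (outer_normal \<phi> \<zeta> x)"
proof -
  let ?p = "outer_normal \<phi> \<zeta> x" and ?u = "(1 / rounded \<phi> \<zeta> x) *\<^sub>R x"
  note T = finsler_norm_thickened_dual and R = finsler_norm_rounded
  have pos: "0 < rounded \<phi> \<zeta> x" by (rule finsler_norm_pos[OF R x])
  have p0: "?p \<noteq> 0" using thickened_dual_outer_normal[OF x] finsler_norm_zero[OF T] by auto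
  have "rounded \<phi> \<zeta> ?u \<le> 1" using pos by (simp add: finsler_norm_scaleR[OF R])
  moreover have "?u \<bullet> ?p = 1" using pos by (simp add: outer_normal_inner)
  ultimately have "?u \<in> subdifferential (thickened_dual \<phi> \<zeta>) ?p"
    by (simp add: subdifferential_finsler_norm[OF T] thickened_dual_outer_normal[OF x]
        flip: rounded_def)
  then show ?thesis
    by (auto simp: subdifferential_thickened_dual[OF p0] sgn_div_norm divide_inverse)
qed

text \<open>
  The key estimate. Monotonicity of \<open>\<partial>\<phi>\<^sup>*\<close> is used for the subgradients of the preceding lemma; the
  inward shifts by \<open>\<zeta>\<close> contribute a term that is quadratic in the difference of the normals, which
  is strict monotonicity with a constant proportional to \<open>\<zeta>\<close>.
\<close>

lemma outer_normal_lipschitz: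
  obtains C where "0 < C"
    "\<And>x y. x \<noteq> 0 \<Longrightarrow> y \<noteq> 0 \<Longrightarrow>
       norm (outer_normal \<phi> \<zeta> x - outer_normal \<phi> \<zeta> y) \<le> C / norm x * norm (x - y)"
proof -
  note T = finsler_norm_thickened_dual and R = finsler_norm_rounded
  obtain M where M: "0 < M" "\<And>p. thickened_dual \<phi> \<zeta> p \<le> M * norm p"
    using finsler_norm_equivalent_norm[OF T] by metis
  obtain A where A: "0 < A" "\<And>p q. p \<noteq> 0 \<Longrightarrow> q \<noteq> 0 \<Longrightarrow>
      norm ((1 / thickened_dual \<phi> \<zeta> p) *\<^sub>R p - (1 / thickened_dual \<phi> \<zeta> q) *\<^sub>R q)
        \<le> A / norm p * norm (p - q)"
    using finsler_radial_projection_lipschitz[OF T] by metis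
  obtain B where B: "0 < B" "\<And>x y. x \<noteq> 0 \<Longrightarrow> y \<noteq> 0 \<Longrightarrow>
      norm ((1 / rounded \<phi> \<zeta> x) *\<^sub>R x - (1 / rounded \<phi> \<zeta> y) *\<^sub>R y) \<le> B / norm x * norm (x - y)"
    using finsler_radial_projection_lipschitz[OF R] by metis
  have "norm (outer_normal \<phi> \<zeta> x - outer_normal \<phi> \<zeta> y) \<le> (M * A\<^sup>2 / \<zeta> * B) / norm x * norm (x - y)"
    if x: "x \<noteq> 0" and y: "y \<noteq> 0" for x y
  proof -
    define p q where "p = outer_normal \<phi> \<zeta> x" and "q = outer_normal \<phi> \<zeta> y"
    define u v where "u = (1 / rounded \<phi> \<zeta> x) *\<^sub>R x" and "v = (1 / rounded \<phi> \<zeta> y) *\<^sub>R y"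
    define s where "s = norm (sgn p - sgn q)"
    have p1: "thickened_dual \<phi> \<zeta> p = 1" and q1: "thickened_dual \<phi> \<zeta> q = 1"
      using thickened_dual_outer_normal x y by (simp_all add: p_def q_def)
    have p0: "p \<noteq> 0" and q0: "q \<noteq> 0" using p1 q1 finsler_norm_zero[OF T] by auto
    have psgn: "p = norm p *\<^sub>R sgn p" and qsgn: "q = norm q *\<^sub>R sgn q"
      using p0 q0 by (simp_all add: sgn_div_norm)
    \<comment> \<open>A point of the dual sphere is the radial projection of its Euclidean direction.\<close>
    have pq: "norm (p - q) \<le> A * s"
    proof -
      have eq: "(1 / thickened_dual \<phi> \<zeta> (sgn r)) *\<^sub>R sgn r = r"
        if "thickened_dual \<phi> \<zeta> r = 1" "r \<noteq> 0" for r
        using that by (simp add: sgn_div_norm finsler_norm_scaleR[OF T])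
      have "sgn p \<noteq> 0" "sgn q \<noteq> 0" using p0 q0 by (simp_all add: sgn_zero_iff)
      from A(2)[OF this] show ?thesis
        by (simp add: eq p1 q1 p0 q0 norm_sgn s_def)
    qed
    have "0 \<le> ((u - \<zeta> *\<^sub>R sgn p) - (v - \<zeta> *\<^sub>R sgn q)) \<bullet> (p - q)"
      using subdifferential_dual_norm_outer_normal x y
      unfolding u_def v_def p_def q_def by (blast intro: subdifferential_monotone)
    also have "\<dots> = (u - v) \<bullet> (p - q) - \<zeta> * ((sgn p - sgn q) \<bullet> (p - q))"
      by (simp add: inner_diff_left algebra_simps)
    finally have mono: "\<zeta> * ((sgn p - sgn q) \<bullet> (p - q)) \<le> norm (u - v) * norm (p - q)"
      using norm_cauchy_schwarz[of "u - v" "p - q"] by linarith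
    \<comment> \<open>Both sides equal \<open>(\<parallel>p\<parallel> + \<parallel>q\<parallel>) (1 - cos \<theta>)\<close> for the angle \<open>\<theta>\<close> between \<open>p\<close> and \<open>q\<close>.\<close>
    have "(sgn p - sgn q) \<bullet> (p - q) = (norm p + norm q) / 2 * s\<^sup>2"
    proof -
      have n: "sgn p \<bullet> sgn p = 1" "sgn q \<bullet> sgn q = 1"
        using p0 q0 by (simp_all add: dot_square_norm norm_sgn)
      have "(sgn p - sgn q) \<bullet> (p - q)
          = (sgn p - sgn q) \<bullet> (norm p *\<^sub>R sgn p - norm q *\<^sub>R sgn q)"
        by (simp flip: psgn qsgn)
      also have "\<dots> = (norm p + norm q) / 2 * ((sgn p - sgn q) \<bullet> (sgn p - sgn q))"
        using n by (simp add: inner_diff_left inner_diff_right inner_commute[of "sgn q" "sgn p"] algebra_simps)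
      finally show ?thesis by (simp add: s_def power2_norm_eq_inner)
    qed
    moreover have "1 / M \<le> (norm p + norm q) / 2"
      using M(2)[of p] M(2)[of q] p1 q1 M(1) by (simp add: field_simps)
    ultimately have "1 / M * s\<^sup>2 \<le> (sgn p - sgn q) \<bullet> (p - q)"
      by (metis mult_right_mono zero_le_power2)
    with mono \<zeta> have "\<zeta> * (1 / M * s\<^sup>2) \<le> norm (u - v) * norm (p - q)"
      by (meson less_imp_le mult_left_mono order_trans)
    then have s2: "\<zeta> * s\<^sup>2 \<le> M * (norm (u - v) * norm (p - q))"
      using M(1) by (simp add: field_simps)
    have "\<zeta> * (norm (p - q))\<^sup>2 \<le> \<zeta> * (A * s)\<^sup>2"
      using pq \<zeta> by (intro mult_left_mono power_mono) auto
    also have "\<dots> = A\<^sup>2 * (\<zeta> * s\<^sup>2)" by (simp add: power_mult_distrib)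
    also have "\<dots> \<le> A\<^sup>2 * (M * (norm (u - v) * norm (p - q)))"
      using s2 by (intro mult_left_mono) auto
    finally have "norm (p - q) * (\<zeta> * norm (p - q)) \<le> norm (p - q) * (M * A\<^sup>2 * norm (u - v))"
      by (simp add: power2_eq_square mult_ac)
    then have "\<zeta> * norm (p - q) \<le> M * A\<^sup>2 * norm (u - v)"
      using M(1) by (cases "p = q") simp_all
    also have "\<dots> \<le> M * A\<^sup>2 * (B / norm x * norm (x - y))"
      using B(2)[OF x y] M(1) unfolding u_def v_def by (intro mult_left_mono) auto
    finally have "norm (p - q) \<le> M * A\<^sup>2 * (B / norm x * norm (x - y)) / \<zeta>"
      by (subst pos_le_divide_eq[OF \<zeta>]) (simp only: mult.commute)
    then show ?thesis by (simp add: p_def q_def mult_ac)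
  qed
  moreover have "0 < M * A\<^sup>2 / \<zeta> * B" using M(1) A(1) B(1) \<zeta> by simp
  ultimately show thesis using that by blast
qed

lemma GDERIV_rounded:
  assumes x: "x \<noteq> 0"
  shows "GDERIV (rounded \<phi> \<zeta>) x :> outer_normal \<phi> \<zeta> x"
proof (rule GDERIV_continuous_selection)
  show "outer_normal \<phi> \<zeta> y \<in> subdifferential (rounded \<phi> \<zeta>) y" for y
    by (rule outer_normal_subdifferential_rounded)
  obtain C where C: "\<And>y. y \<noteq> 0 \<Longrightarrow>
      norm (outer_normal \<phi> \<zeta> x - outer_normal \<phi> \<zeta> y) \<le> C / norm x * norm (x - y)"
    using outer_normal_lipschitz x by metis
  have "((\<lambda>y. y - x) \<longlongrightarrow> 0) (at x)" by (simp add: LIM_zero)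
  moreover have "\<forall>\<^sub>F y in at x. y \<noteq> 0"
    using x by (intro eventually_neq_at_within)
  then have "\<forall>\<^sub>F y in at x.
      norm (outer_normal \<phi> \<zeta> y - outer_normal \<phi> \<zeta> x) \<le> norm (y - x) * (C / norm x)"
    by eventually_elim (use C in \<open>simp add: norm_minus_commute mult.commute\<close>)
  ultimately have "((\<lambda>y. outer_normal \<phi> \<zeta> y - outer_normal \<phi> \<zeta> x) \<longlongrightarrow> 0) (at x)"
    by (rule tendsto_0_le)
  then show "isCont (outer_normal \<phi> \<zeta>) x" by (simp add: isCont_def LIM_zero_iff)
qed

lemma gradient_rounded: "x \<noteq> 0 \<Longrightarrow> gradient (rounded \<phi> \<zeta>) x = outer_normal \<phi> \<zeta> x"
  by (rule gradient_eqI[OF GDERIV_rounded])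

lemma C11_loc_on_rounded: "C11_loc_on (UNIV - {0}) (rounded \<phi> \<zeta>)"
  unfolding C11_loc_on_def
proof (intro conjI ballI allI impI)
  show "rounded \<phi> \<zeta> differentiable (at x)" if "x \<in> UNIV - {0}" for x
    using GDERIV_rounded[of x] that by (auto simp: gderiv_def differentiable_def)
  fix K :: "'a set" assume K: "compact K \<and> K \<subseteq> UNIV - {0}"
  obtain C where C: "0 < C" "\<And>x y. x \<noteq> 0 \<Longrightarrow> y \<noteq> 0 \<Longrightarrow>
      norm (outer_normal \<phi> \<zeta> x - outer_normal \<phi> \<zeta> y) \<le> C / norm x * norm (x - y)"
    using outer_normal_lipschitz by metis
  have "0 \<notin> K" "closed K" using K compact_imp_closed by auto
  then obtain r where r: "0 < r" "\<And>x. x \<in> K \<Longrightarrow> r \<le> norm x"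
    using separate_point_closed[of K 0] by (auto simp: dist_norm)
  have "(C / r)-lipschitz_on K (gradient (rounded \<phi> \<zeta>))"
  proof (rule lipschitz_onI)
    fix x y assume xy: "x \<in> K" "y \<in> K"
    then have x0: "x \<noteq> 0" and y0: "y \<noteq> 0" using \<open>0 \<notin> K\<close> by auto
    have "C / norm x * norm (x - y) \<le> C / r * norm (x - y)"
      using r(2)[OF xy(1)] r(1) C(1) x0 by (intro mult_right_mono divide_left_mono) auto
    with C(2)[OF x0 y0]
    show "dist (gradient (rounded \<phi> \<zeta>) x) (gradient (rounded \<phi> \<zeta>) y) \<le> C / r * dist x y"
      by (simp add: gradient_rounded x0 y0 dist_norm)
  qed (use C(1) r(1) in simp)
  then show "\<exists>L. L-lipschitz_on K (gradient (rounded \<phi> \<zeta>))" by blast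
qed

end

lemma uniform_limit_rounded:
  fixes \<phi> :: "'a::euclidean_space \<Rightarrow> real"
  assumes \<phi>: "finsler_norm \<phi>" and K: "compact K"
  shows "uniform_limit K (rounded \<phi>) \<phi> (at_right 0)"
proof -
  obtain c where c: "0 < c" "\<And>p. c * norm p \<le> dual_norm \<phi> p"
    using finsler_norm_equivalent_norm[OF finsler_norm_dual_norm[OF \<phi>]] by metis
  have "bounded (\<phi> ` K)"
    by (intro compact_imp_bounded compact_continuous_image finsler_norm_continuous \<phi> K)
  then obtain b where b: "\<And>x. x \<in> K \<Longrightarrow> \<bar>\<phi> x\<bar> \<le> b"
    by (auto simp: bounded_iff)
  show ?thesis
  proof (rule uniform_limitI)
    fix e :: real assume e: "0 < e"
    have "((\<lambda>\<zeta>. \<zeta> / c * b) \<longlongrightarrow> 0 / c * b) (at_right 0)"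
      using c by (intro tendsto_intros) auto
    then have "\<forall>\<^sub>F \<zeta> in at_right 0. \<zeta> / c * b < e"
      using e by (intro order_tendstoD) auto
    then show "\<forall>\<^sub>F \<zeta> in at_right 0. \<forall>x\<in>K. dist (rounded \<phi> \<zeta> x) (\<phi> x) < e"
      using eventually_at_right_less[of "0::real"]
    proof eventually_elim
      case (elim \<zeta>)
      show ?case
      proof
        fix x assume x: "x \<in> K"
        have le: "rounded \<phi> \<zeta> x \<le> \<phi> x" using rounded_le[OF \<phi>] elim by simp
        have "\<phi> x \<le> rounded \<phi> \<zeta> x + \<zeta> / c * rounded \<phi> \<zeta> x"
          using le_rounded[OF \<phi> elim(2) c, of x] by (simp add: algebra_simps)
        also have "\<zeta> / c * rounded \<phi> \<zeta> x \<le> \<zeta> / c * b"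
          using le b[OF x] elim c by (intro mult_left_mono) auto
        finally have "\<phi> x - rounded \<phi> \<zeta> x < e" using elim by simp
        with le show "dist (rounded \<phi> \<zeta> x) (\<phi> x) < e" by (simp add: dist_real_def)
      qed
    qed
  qed
qed

theorem theorem5:
  fixes \<phi> :: "real ^ 'd \<Rightarrow> real"
  assumes "finsler_norm \<phi>"
  shows "\<exists>(\<Phi> :: real \<Rightarrow> real ^ 'd \<Rightarrow> real) (\<kappa> :: real) (\<delta> :: real).
    \<kappa> > 0 \<and> \<delta> > 0 \<and>
    (\<forall>\<zeta>>0. finsler_norm (\<Phi> \<zeta>) \<and> C11_loc_on (UNIV - {0}) (\<Phi> \<zeta>)) \<and>
    (\<forall>K. compact K \<longrightarrow> uniform_limit K \<Phi> \<phi> (at_right 0)) \<and>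
    (\<forall>\<zeta>. 0 < \<zeta> \<and> \<zeta> < 1 \<longrightarrow>
       uniform_interior_ball \<zeta> {x. \<Phi> \<zeta> x \<le> 1} \<and>
       (\<forall>p. p \<noteq> 0 \<longrightarrow>
          subdifferential (dual_norm (\<Phi> \<zeta>)) p =
          (\<lambda>v. v + (\<zeta> / norm p) *\<^sub>R p) ` subdifferential (dual_norm \<phi>) p) \<and>
       (\<forall>x. \<Phi> \<zeta> x \<le> \<phi> x) \<and>
       (\<forall>x. x \<noteq> 0 \<longrightarrow> \<kappa> \<le> dual_norm \<phi> (gradient (\<Phi> \<zeta>) x)) \<and>
       cball 0 \<delta> \<subseteq> {x. \<Phi> \<zeta> x \<le> 1} \<and>
       {x. \<Phi> \<zeta> x \<le> 1} \<subseteq> cball 0 (inverse \<delta>))"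
proof -
  note \<phi> = assms
  obtain m M where mM: "0 < m" "0 < M" "\<And>x. m * norm x \<le> \<phi> x" "\<And>x. \<phi> x \<le> M * norm x"
    using finsler_norm_equivalent_norm[OF \<phi>] by blast
  obtain c where c: "0 < c" "\<And>p. c * norm p \<le> dual_norm \<phi> p"
    using finsler_norm_equivalent_norm[OF finsler_norm_dual_norm[OF \<phi>]] by metis
  define r where "r = 1 + 1 / c"
  have r: "0 < r" unfolding r_def using c by (simp add: add_pos_pos)
  define \<delta> where "\<delta> = min (1 / M) (m / r)"
  have \<delta>: "0 < \<delta>" using mM r by (simp add: \<delta>_def)
  have kappa: "1 / r \<le> dual_norm \<phi> (gradient (rounded \<phi> \<zeta>) x)"
    if \<zeta>: "0 < \<zeta>" "\<zeta> < 1" and x: "x \<noteq> 0" for \<zeta> x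
  proof -
    define p where "p = outer_normal \<phi> \<zeta> x"
    have "1 = dual_norm \<phi> p + \<zeta> * norm p"
      using thickened_dual_outer_normal[OF \<phi> \<zeta>(1) x] by (simp add: p_def thickened_dual_def)
    also have "\<zeta> * norm p \<le> 1 * norm p" using \<zeta> by (intro mult_right_mono) auto
    also have "1 * norm p \<le> dual_norm \<phi> p / c" using c by (simp add: field_simps)
    finally have "1 \<le> r * dual_norm \<phi> p" by (simp add: r_def algebra_simps)
    then show ?thesis
      using r by (simp add: gradient_rounded[OF \<phi> \<zeta>(1) x] p_def field_simps)
  qed
  have inner: "cball 0 \<delta> \<subseteq> {x. rounded \<phi> \<zeta> x \<le> 1}" if \<zeta>: "0 < \<zeta>" for \<zeta>
  proof
    fix x :: "real ^ 'd" assume "x \<in> cball 0 \<delta>"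
    then have "norm x \<le> 1 / M" by (simp add: \<delta>_def)
    then have "M * norm x \<le> 1" using mM by (simp add: field_simps)
    with rounded_le[OF \<phi> \<zeta>, of x] mM(4)[of x] show "x \<in> {x. rounded \<phi> \<zeta> x \<le> 1}" by simp
  qed
  have outer: "{x. rounded \<phi> \<zeta> x \<le> 1} \<subseteq> cball 0 (inverse \<delta>)" if \<zeta>: "0 < \<zeta>" "\<zeta> < 1" for \<zeta>
  proof
    fix x assume "x \<in> {x. rounded \<phi> \<zeta> x \<le> 1}"
    then have x: "rounded \<phi> \<zeta> x \<le> 1" by simp
    have "m * norm x \<le> (1 + \<zeta> / c) * rounded \<phi> \<zeta> x"
      using mM(3)[of x] le_rounded[OF \<phi> \<zeta>(1) c, of x] by simp
    also have "\<dots> \<le> (1 + \<zeta> / c) * 1" using x \<zeta> c by (intro mult_left_mono) auto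
    also have "\<dots> \<le> r" using \<zeta> c by (simp add: r_def divide_right_mono)
    finally have "norm x \<le> inverse (m / r)" using mM r by (simp add: field_simps)
    also have "\<dots> \<le> inverse \<delta>" using \<delta> by (intro le_imp_inverse_le) (auto simp: \<delta>_def)
    finally show "x \<in> cball 0 (inverse \<delta>)" by simp
  qed
  show ?thesis
  proof (rule exI[of _ "rounded \<phi>"], rule exI[of _ "1 / r"], rule exI[of _ \<delta>],
      intro conjI allI impI)
    show "1 / r > 0" "\<delta> > 0" using r \<delta> by simp_all
  next
    fix \<zeta> :: real assume "0 < \<zeta>"
    then show "finsler_norm (rounded \<phi> \<zeta>)" "C11_loc_on (UNIV - {0}) (rounded \<phi> \<zeta>)"
      by (rule finsler_norm_rounded[OF \<phi>], rule C11_loc_on_rounded[OF \<phi>])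
  next
    fix K :: "(real ^ 'd) set" assume "compact K"
    then show "uniform_limit K (rounded \<phi>) \<phi> (at_right 0)" by (rule uniform_limit_rounded[OF \<phi>])
  next
    fix \<zeta> :: real assume "0 < \<zeta> \<and> \<zeta> < 1"
    then have \<zeta>: "0 < \<zeta>" "\<zeta> < 1" by auto
    show "uniform_interior_ball \<zeta> {x. rounded \<phi> \<zeta> x \<le> 1}"
      by (rule uniform_interior_ball_rounded[OF \<phi> \<zeta>(1)])
    show "subdifferential (dual_norm (rounded \<phi> \<zeta>)) p =
        (\<lambda>v. v + (\<zeta> / norm p) *\<^sub>R p) ` subdifferential (dual_norm \<phi>) p" if "p \<noteq> 0" for p
      unfolding dual_norm_rounded[OF \<phi> \<zeta>(1)]
      by (rule subdifferential_thickened_dual[OF \<phi> \<zeta>(1) that])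
    show "rounded \<phi> \<zeta> x \<le> \<phi> x" for x by (rule rounded_le[OF \<phi> \<zeta>(1)])
    show "1 / r \<le> dual_norm \<phi> (gradient (rounded \<phi> \<zeta>) x)" if "x \<noteq> 0" for x
      by (rule kappa[OF \<zeta> that])
    show "cball 0 \<delta> \<subseteq> {x. rounded \<phi> \<zeta> x \<le> 1}" by (rule inner[OF \<zeta>(1)])
    show "{x. rounded \<phi> \<zeta> x \<le> 1} \<subseteq> cball 0 (inverse \<delta>)" by (rule outer[OF \<zeta>])
  qed
qed

end
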